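(* Let $d\in\mathbb{N}$. For $D$-norms $\|\cdot\|_{D^{(1)}}$, $\|\cdot\|_{D^{(2)}}$ on $\mathbb{R}^d$, let $\bm{Z}^{(1)}$, $\bm{Z}^{(2)}$ be independent generators of them and let $\|\cdot\|_{D^{(1)}D^{(2)}}$ be the $D$-norm generated by the componentwise product $\bm{Z}^{(1)}\bm{Z}^{(2)}$. Then $\|\cdot\|_{D^{(1)}D^{(2)}}$ does not depend on the particular choice of the independent generators, and the set of all $D$-norms on $\mathbb{R}^d$, equipped with the multiplication $(\|\cdot\|_{D^{(1)}},\|\cdot\|_{D^{(2)}})\mapsto \|\cdot\|_{D^{(1)}D^{(2)}}$, is a commutative semigroup with identity element $\|\cdot\|_\infty$.
   Context: A generator is a random vector $\bm{Z}=(Z_1,\dots,Z_d)$ with $Z_i\ge 0$ almost surely and $E(Z_i)=1$ for $1\le i\le d$. The $D$-norm on $\mathbb{R}^d$ generated by $\bm{Z}$ is $\|\bm{x}\|_D:=E\left(\max_{1\le i\le d}(|x_i|Z_i)\right)$, $\bm{x}\in\mathbb{R}^d$. A $D$-norm is a norm on $\mathbb{R}^d$ that arises in this way from some generator; the generator of a $D$-norm is not unique. The sup-norm $\|\bm{x}\|_\infty=\max_{1\le i\le d}|x_i|$ is a $D$-norm (generated, for example, by the constant vector $(1,\dots,1)$). Products of vectors are componentwise. *)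

theory Defs
  imports "HOL-Probability.Probability" "HOL-Algebra.Group"
begin

(* The library sets the integral of a non-integrable function to 0, so an expectation equal to 1
   includes integrability. *)
definition generator :: "'a measure \<Rightarrow> ('a \<Rightarrow> real ^ 'n) \<Rightarrow> bool" where
  "generator M Z \<longleftrightarrow> prob_space M \<and> Z \<in> borel_measurable M \<and>
     (\<forall>i. (AE \<omega> in M. 0 \<le> Z \<omega> $ i) \<and> (\<integral>\<omega>. Z \<omega> $ i \<partial>M) = 1)"

definition generated_norm :: "'a measure \<Rightarrow> ('a \<Rightarrow> real ^ 'n) \<Rightarrow> (real ^ 'n \<Rightarrow> real)" where
  "generated_norm M Z = (\<lambda>x. \<integral>\<omega>. (MAX i. \<bar>x $ i\<bar> * Z \<omega> $ i) \<partial>M)"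

definition generates :: "'a measure \<Rightarrow> ('a \<Rightarrow> real ^ 'n) \<Rightarrow> (real ^ 'n \<Rightarrow> real) \<Rightarrow> bool" where
  "generates M Z N \<longleftrightarrow> generator M Z \<and> N = generated_norm M Z"

definition indep_generators ::
  "'a measure \<Rightarrow> ('a \<Rightarrow> real ^ 'n) \<Rightarrow> ('a \<Rightarrow> real ^ 'n) \<Rightarrow>
   (real ^ 'n \<Rightarrow> real) \<Rightarrow> (real ^ 'n \<Rightarrow> real) \<Rightarrow> bool" where
  "indep_generators M Z1 Z2 N1 N2 \<longleftrightarrow>
     generates M Z1 N1 \<and> generates M Z2 N2 \<and> prob_space.indep_var M borel Z1 borel Z2"

(* HOL cannot quantify over the type of the sample space inside a formula. The choice of R^n
   loses no generator, see generates_imp_D_norm; that the members are norms (not part of the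
   definition) is D_norm_is_norm. *)
definition D_norms :: "(real ^ 'n \<Rightarrow> real) set" where
  "D_norms = {N. \<exists>(M :: (real ^ 'n) measure) Z. generates M Z N}"

(* Here too a sample space type must be fixed; R^n x R^n carries independent copies of any two
   generators. *)
definition D_norm_mult ::
  "(real ^ 'n \<Rightarrow> real) \<Rightarrow> (real ^ 'n \<Rightarrow> real) \<Rightarrow> (real ^ 'n \<Rightarrow> real)" where
  "D_norm_mult N1 N2 = (THE N. \<exists>(M :: ((real ^ 'n) \<times> (real ^ 'n)) measure) Z1 Z2.
     indep_generators M Z1 Z2 N1 N2 \<and> generates M (\<lambda>\<omega>. Z1 \<omega> * Z2 \<omega>) N)"

definition D_norm_monoid :: "(real ^ 'n \<Rightarrow> real) monoid" where
  "D_norm_monoid = \<lparr>carrier = D_norms, monoid.mult = D_norm_mult, one = infnorm\<rparr>"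

lemma infnorm_eq_MAX: "infnorm (x :: real ^ 'n) = (MAX i. \<bar>x $ i\<bar>)"
proof -
  have "{\<bar>x $ i\<bar> |i. i \<in> UNIV} = range (\<lambda>i. \<bar>x $ i\<bar>)" by auto
  then show ?thesis by (simp add: infnorm_cart cSup_eq_Max)
qed

lemma generates_imp_D_norm:
  fixes M :: "'a measure" and Z :: "'a \<Rightarrow> real ^ 'n"
  assumes "generates M Z N"
  shows "N \<in> D_norms"
proof -
  have M: "prob_space M" and Z [measurable]: "Z \<in> borel_measurable M"
    and ZP: "\<And>i. AE \<omega> in M. 0 \<le> Z \<omega> $ i" "\<And>i. (\<integral>\<omega>. Z \<omega> $ i \<partial>M) = 1"
    and N: "N = generated_norm M Z"
    using assms by (auto simp: generates_def generator_def)
  let ?L = "distr M borel Z"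
  have [measurable]: "(\<lambda>y::real^'n. MAX i. \<bar>x $ i\<bar> * y $ i) \<in> borel_measurable borel" for x
    by (rule borel_measurable_Max) auto
  have "generator ?L (\<lambda>y. y)"
    unfolding generator_def
  proof (intro conjI allI)
    show "prob_space ?L" by (rule prob_space.prob_space_distr[OF M Z])
    show "(\<lambda>y. y) \<in> borel_measurable ?L" by simp
    show "AE y in ?L. 0 \<le> y $ i" for i by (subst AE_distr_iff) (use ZP in auto)
    show "(\<integral>y. y $ i \<partial>?L) = 1" for i by (subst integral_distr) (use ZP in auto)
  qed
  moreover have "generated_norm ?L (\<lambda>y. y) = N"
    unfolding N generated_norm_def by (intro ext, subst integral_distr) auto
  ultimately show ?thesis unfolding D_norms_def generates_def by blast
qed

lemma D_norm_is_norm: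
  fixes N :: "real ^ 'n \<Rightarrow> real"
  assumes "N \<in> D_norms"
  shows "0 \<le> N x" and "N x = 0 \<longleftrightarrow> x = 0" and "N (c *\<^sub>R x) = \<bar>c\<bar> * N x" and "N (x + y) \<le> N x + N y"
proof -
  obtain M :: "(real ^ 'n) measure" and Z where M: "prob_space M"
    and Z [measurable]: "Z \<in> borel_measurable M"
    and nn: "\<And>i. AE \<omega> in M. 0 \<le> Z \<omega> $ i" and E: "\<And>i. (\<integral>\<omega>. Z \<omega> $ i \<partial>M) = 1"
    and N: "N = generated_norm M Z"
    using assms by (auto simp: D_norms_def generates_def generator_def)
  define m where "m = (\<lambda>x \<omega>. MAX i. \<bar>x $ i\<bar> * Z \<omega> $ i)"
  have N': "N x = (\<integral>\<omega>. m x \<omega> \<partial>M)" for x by (simp add: N generated_norm_def m_def)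
  have "integrable M (\<lambda>\<omega>. Z \<omega> $ i)" for i
    using E[of i] not_integrable_integral_eq[of M "\<lambda>\<omega>. Z \<omega> $ i"] by fastforce
  then have int: "integrable M (m x)" for x
    unfolding m_def by (intro integrable_MAX) auto
  have nn': "AE \<omega> in M. \<forall>i. 0 \<le> Z \<omega> $ i" using nn by (simp add: AE_all_countable)
  have up: "\<bar>x $ i\<bar> * Z \<omega> $ i \<le> m x \<omega>" for x i \<omega> unfolding m_def by (rule Max_ge) auto
  have lower: "\<bar>x $ i\<bar> \<le> N x" for x i
  proof -
    have "\<bar>x $ i\<bar> = (\<integral>\<omega>. \<bar>x $ i\<bar> * Z \<omega> $ i \<partial>M)" by (simp add: E)
    also have "\<dots> \<le> N x" unfolding N'
      by (rule integral_mono) (use up int \<open>\<And>i. integrable M (\<lambda>\<omega>. Z \<omega> $ i)\<close> in auto)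
    finally show ?thesis .
  qed
  show "0 \<le> N x" using lower[of x undefined] by linarith
  have "N 0 = 0" by (simp add: N' m_def)
  then show "N x = 0 \<longleftrightarrow> x = 0"
    using lower[of x] by (metis abs_le_zero_iff vec_eq_iff zero_index)
  have "m (c *\<^sub>R x) \<omega> = \<bar>c\<bar> * m x \<omega>" for \<omega>
  proof -
    have "mono (\<lambda>t. \<bar>c\<bar> * t)" by (auto intro!: monoI mult_left_mono)
    from mono_Max_commute[OF this, of "range (\<lambda>i. \<bar>x $ i\<bar> * Z \<omega> $ i)"] show ?thesis
      by (simp add: m_def image_image abs_mult mult.assoc)
  qed
  then show "N (c *\<^sub>R x) = \<bar>c\<bar> * N x" by (simp add: N')
  have "N (x + y) \<le> (\<integral>\<omega>. m x \<omega> + m y \<omega> \<partial>M)" unfolding N'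
  proof (rule integral_mono_AE)
    show "AE \<omega> in M. m (x + y) \<omega> \<le> m x \<omega> + m y \<omega>" using nn'
    proof eventually_elim
      case (elim \<omega>)
      have "\<bar>(x + y) $ i\<bar> * Z \<omega> $ i \<le> m x \<omega> + m y \<omega>" for i
      proof -
        have "\<bar>(x + y) $ i\<bar> * Z \<omega> $ i \<le> (\<bar>x $ i\<bar> + \<bar>y $ i\<bar>) * Z \<omega> $ i"
          using elim by (intro mult_right_mono) auto
        also have "\<dots> \<le> m x \<omega> + m y \<omega>"
          using add_mono[OF up[of x i \<omega>] up[of y i \<omega>]] by (simp add: distrib_right)
        finally show ?thesis .
      qed
      then have "(MAX i. \<bar>(x + y) $ i\<bar> * Z \<omega> $ i) \<le> m x \<omega> + m y \<omega>"
        by (intro Max.boundedI) auto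
      then show ?case by (simp add: m_def)
    qed
  qed (use int in auto)
  then show "N (x + y) \<le> N x + N y" using int by (simp add: N')
qed

end

theory Submission
  imports Defs
begin

text \<open>Integrating out \<open>Z1\<close> first, Fubini gives \<open>\<parallel>x\<parallel> = E (N1 (x * Z2))\<close> for the norm generated by
  \<open>Z1 * Z2\<close>, so the law of \<open>Z1\<close> enters only through \<open>N1\<close>, and symmetrically for \<open>Z2\<close>. Given a second
  independent pair \<open>(W1, W2)\<close>, one may therefore pass through an independent coupling of \<open>Z1\<close> and
  \<open>W2\<close>, replacing one factor at a time. The same formula reduces associativity to Fubini.\<close>

section \<open>Measurability and change of sample space\<close>

lemma borel_measurable_vec_nth_comp [measurable (raw)]:
  fixes f :: "'a \<Rightarrow> real ^ 'n"
  assumes "f \<in> borel_measurable M"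
  shows "(\<lambda>\<omega>. f \<omega> $ i) \<in> borel_measurable M"
  using measurable_compose[OF assms borel_measurable_nth] .

lemma borel_measurable_vec_times [measurable (raw)]:
  fixes f g :: "'a \<Rightarrow> real ^ 'n"
  assumes [measurable]: "f \<in> borel_measurable M" "g \<in> borel_measurable M"
  shows "(\<lambda>\<omega>. f \<omega> * g \<omega>) \<in> borel_measurable M"
  by (subst borel_measurable_euclidean_space) (auto simp: Basis_vec_def inner_axis)

text \<open>Change of variables. With \<open>T\<close> a coordinate projection of a product measure,
  this lifts a generator from a factor to the product.\<close>

lemma generates_distr_iff:
  assumes T [measurable]: "T \<in> measurable M M'" and Z [measurable]: "Z \<in> borel_measurable M'"
    and M: "prob_space M"
  shows "generates (distr M M' T) Z N \<longleftrightarrow> generates M (\<lambda>\<omega>. Z (T \<omega>)) N"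
proof -
  have "(\<lambda>\<omega>. MAX i. \<bar>x $ i\<bar> * Z \<omega> $ i) \<in> borel_measurable M'" for x
    by (intro borel_measurable_Max) measurable
  then have "generated_norm (distr M M' T) Z = generated_norm M (\<lambda>\<omega>. Z (T \<omega>))"
    unfolding generated_norm_def by (intro ext, subst integral_distr) auto
  moreover have "generator (distr M M' T) Z \<longleftrightarrow> generator M (\<lambda>\<omega>. Z (T \<omega>))"
    using M prob_space.prob_space_distr[OF M T]
    by (simp add: generator_def AE_distr_iff integral_distr)
  ultimately show ?thesis by (simp add: generates_def)
qed

text \<open>Integrability is forced by the mean: a non-integrable coordinate would have the default
  integral 0, not 1.\<close>

lemma generatesD:
  assumes "generates M Z N"
  shows "prob_space M" "Z \<in> borel_measurable M" "AE \<omega> in M. \<forall>i. 0 \<le> Z \<omega> $ i"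
    "integrable M (\<lambda>\<omega>. Z \<omega> $ i)" "(\<integral>\<omega>. Z \<omega> $ i \<partial>M) = 1" "N = generated_norm M Z"
  using assms not_integrable_integral_eq[of M "\<lambda>\<omega>. Z \<omega> $ i"]
  by (fastforce simp: generates_def generator_def AE_all_countable)+

section \<open>Independent pairs of generators\<close>

lemma indep_generatorsD:
  assumes "indep_generators M Z1 Z2 N1 N2"
  shows "generates M Z1 N1" "generates M Z2 N2" "prob_space.indep_var M borel Z1 borel Z2"
  using assms by (auto simp: indep_generators_def)

text \<open>Independence says that the joint law is the product of the marginals, and swapping
  coordinates preserves this. It provides the mirror image of formulas that integrate out the first
  factor.\<close>

lemma indep_generators_sym:
  assumes "indep_generators M Z1 Z2 N1 N2"
  shows "indep_generators M Z2 Z1 N2 N1"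
proof -
  note g = indep_generatorsD[OF assms]
  interpret prob_space M by (rule generatesD(1)[OF g(1)])
  have [measurable]: "Z1 \<in> borel_measurable M" "Z2 \<in> borel_measurable M"
    using generatesD(2)[OF g(1)] generatesD(2)[OF g(2)] .
  interpret P: prob_space "distr M borel Z1" by (rule prob_space_distr) simp
  interpret Q: prob_space "distr M borel Z2" by (rule prob_space_distr) simp
  interpret pair_sigma_finite "distr M borel Z2" "distr M borel Z1" ..
  have "distr M borel Z2 \<Otimes>\<^sub>M distr M borel Z1 = distr M (borel \<Otimes>\<^sub>M borel) (\<lambda>\<omega>. (Z2 \<omega>, Z1 \<omega>))"
    using g(3) unfolding indep_var_distribution_eq
    by (subst distr_pair_swap) (auto simp: distr_distr comp_def intro!: distr_cong sets_pair_measure_cong)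
  then show ?thesis
    using g by (simp add: indep_generators_def indep_var_distribution_eq)
qed

text \<open>The coordinates of a product measure are independent, so any two generators have an
  independent coupling, even when they live on different sample spaces.\<close>

lemma indep_generators_pair:
  assumes "generates M1 Z1 N1" and "generates M2 Z2 N2"
  shows "indep_generators (M1 \<Otimes>\<^sub>M M2) (\<lambda>\<omega>. Z1 (fst \<omega>)) (\<lambda>\<omega>. Z2 (snd \<omega>)) N1 N2"
proof -
  interpret M1: prob_space M1 by (rule generatesD(1)[OF assms(1)])
  interpret M2: prob_space M2 by (rule generatesD(1)[OF assms(2)])
  interpret pair_prob_space M1 M2 ..
  have [measurable]: "Z1 \<in> borel_measurable M1" "Z2 \<in> borel_measurable M2"
    using generatesD(2)[OF assms(1)] generatesD(2)[OF assms(2)] .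
  have fst: "distr (M1 \<Otimes>\<^sub>M M2) M1 fst = M1" by (rule M2.distr_pair_fst)
  \<comment> \<open>The second marginal is the first marginal after a swap of the factors.\<close>
  have snd: "distr (M1 \<Otimes>\<^sub>M M2) M2 snd = M2"
    by (subst distr_pair_swap) (simp add: distr_distr comp_def case_prod_beta M1.distr_pair_fst)
  have "generates (M1 \<Otimes>\<^sub>M M2) (\<lambda>\<omega>. Z1 (fst \<omega>)) N1"
    using generates_distr_iff[of fst "M1 \<Otimes>\<^sub>M M2" M1 Z1 N1] assms(1) prob_space_axioms
    by (simp add: fst)
  moreover have "generates (M1 \<Otimes>\<^sub>M M2) (\<lambda>\<omega>. Z2 (snd \<omega>)) N2"
    using generates_distr_iff[of snd "M1 \<Otimes>\<^sub>M M2" M2 Z2 N2] assms(2) prob_space_axioms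
    by (simp add: snd)
  moreover have "indep_var borel (\<lambda>\<omega>. Z1 (fst \<omega>)) borel (\<lambda>\<omega>. Z2 (snd \<omega>))"
  proof -
    have "distr (M1 \<Otimes>\<^sub>M M2) borel (\<lambda>\<omega>. Z1 (fst \<omega>)) = distr M1 borel Z1"
      by (subst (2) fst[symmetric]) (simp add: distr_distr comp_def)
    moreover have "distr (M1 \<Otimes>\<^sub>M M2) borel (\<lambda>\<omega>. Z2 (snd \<omega>)) = distr M2 borel Z2"
      by (subst (2) snd[symmetric]) (simp add: distr_distr comp_def)
    moreover interpret Q: prob_space "distr M2 borel Z2" by (rule M2.prob_space_distr) simp
    have "distr M1 borel Z1 \<Otimes>\<^sub>M distr M2 borel Z2 =
        distr (M1 \<Otimes>\<^sub>M M2) (borel \<Otimes>\<^sub>M borel) (\<lambda>(x, y). (Z1 x, Z2 y))"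
      by (rule pair_measure_distr) (simp_all add: Q.sigma_finite_measure_axioms)
    ultimately show ?thesis
      unfolding indep_var_distribution_eq by (simp add: case_prod_beta')
  qed
  ultimately show ?thesis by (simp add: indep_generators_def)
qed

text \<open>Expectation is multiplicative on independent integrable variables, so every coordinate
  of the product again has mean 1.\<close>

lemma indep_generators_prod:
  assumes "indep_generators M Z1 Z2 N1 N2"
  shows "generates M (\<lambda>\<omega>. Z1 \<omega> * Z2 \<omega>) (generated_norm M (\<lambda>\<omega>. Z1 \<omega> * Z2 \<omega>))"
proof -
  note g = indep_generatorsD[OF assms]
  note g1 = generatesD[OF g(1)] and g2 = generatesD[OF g(2)]
  interpret prob_space M by (rule g1(1))
  have [measurable]: "Z1 \<in> borel_measurable M" "Z2 \<in> borel_measurable M" using g1(2) g2(2) .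
  have ind: "indep_var borel (\<lambda>\<omega>. Z1 \<omega> $ i) borel (\<lambda>\<omega>. Z2 \<omega> $ i)" for i
    using indep_var_compose[OF g(3), of "\<lambda>y. y $ i" borel "\<lambda>y. y $ i" borel]
    by (simp add: comp_def)
  have "AE \<omega> in M. 0 \<le> (Z1 \<omega> * Z2 \<omega>) $ i" for i
    using g1(3) g2(3) by eventually_elim simp
  moreover have "(\<integral>\<omega>. (Z1 \<omega> * Z2 \<omega>) $ i \<partial>M) = 1" for i
    using indep_var_lebesgue_integral[OF ind g1(4) g2(4)] by (simp add: g1(5) g2(5))
  moreover have "(\<lambda>\<omega>. Z1 \<omega> * Z2 \<omega>) \<in> borel_measurable M"
    by measurable
  ultimately show ?thesis by (simp add: generates_def generator_def g1(1))
qed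

section \<open>The Fubini formula and independence of the choice of generators\<close>

text \<open>As \<open>Z2\<close> is nonnegative almost everywhere, it can be absorbed into the
  absolute value of \<open>x\<close>; freezing it at \<open>z\<close> and averaging over
  \<open>Z1\<close> then gives \<open>N1 (x * z)\<close>. Integrability is recorded for later uses
  of Fubini.\<close>

lemma generated_norm_prod:
  assumes "indep_generators M Z1 Z2 N1 N2"
  shows "integrable M (\<lambda>\<omega>. N1 (x * Z2 \<omega>))"
    and "generated_norm M (\<lambda>\<omega>. Z1 \<omega> * Z2 \<omega>) x = (\<integral>\<omega>. N1 (x * Z2 \<omega>) \<partial>M)"
proof -
  note g = indep_generatorsD[OF assms]
  note g1 = generatesD[OF g(1)] and g2 = generatesD[OF g(2)]
  note gp = generatesD[OF indep_generators_prod[OF assms]]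
  interpret prob_space M by (rule g1(1))
  have [measurable]: "Z1 \<in> borel_measurable M" "Z2 \<in> borel_measurable M" using g1(2) g2(2) .
  let ?P = "distr M borel Z1" and ?Q = "distr M borel Z2"
  interpret P: prob_space ?P by (rule prob_space_distr) simp
  interpret Q: prob_space ?Q by (rule prob_space_distr) simp
  interpret PQ: pair_sigma_finite ?P ?Q ..
  \<comment> \<open>The absolute value covers \<open>z\<close> too, so that \<open>inner\<close>
    holds for every \<open>z\<close>, whatever its signs; in return \<open>h\<close> matches the
    original integrand only almost everywhere.\<close>
  define h where "h = (\<lambda>(y, z). MAX i. \<bar>(x * z) $ i\<bar> * y $ i)"
  have h_meas [measurable]: "h \<in> borel_measurable (borel \<Otimes>\<^sub>M borel)"
    unfolding h_def case_prod_beta by (intro borel_measurable_Max) measurable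
  have joint: "?P \<Otimes>\<^sub>M ?Q = distr M (borel \<Otimes>\<^sub>M borel) (\<lambda>\<omega>. (Z1 \<omega>, Z2 \<omega>))"
    using g(3) unfolding indep_var_distribution_eq by simp
  have eq: "AE \<omega> in M. (MAX i. \<bar>x $ i\<bar> * (Z1 \<omega> * Z2 \<omega>) $ i) = h (Z1 \<omega>, Z2 \<omega>)"
    using g2(3) by eventually_elim (simp add: h_def abs_mult mult_ac)
  have "integrable M (\<lambda>\<omega>. MAX i. \<bar>x $ i\<bar> * (Z1 \<omega> * Z2 \<omega>) $ i)"
    using gp(4) by (intro integrable_MAX) auto
  then have "integrable M (\<lambda>\<omega>. h (Z1 \<omega>, Z2 \<omega>))"
    by (subst integrable_cong_AE[THEN sym]) (use eq in auto)
  then have int: "integrable (?P \<Otimes>\<^sub>M ?Q) h"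
    unfolding joint by (subst integrable_distr_eq) auto
  have inner: "(\<integral>y. h (y, z) \<partial>?P) = N1 (x * z)" for z
  proof -
    have "(\<lambda>y. h (y, z)) \<in> borel_measurable borel" by measurable
    then show ?thesis by (simp add: integral_distr h_def g1(6) generated_norm_def)
  qed
  have intQ: "integrable ?Q (\<lambda>z. N1 (x * z))"
    using PQ.integrable_snd[of "\<lambda>y z. h (y, z)"] int by (simp add: inner)
  \<comment> \<open>Measurability comes out of Fubini here, with no appeal to continuity of
    \<open>N1\<close>.\<close>
  then have "(\<lambda>z. N1 (x * z)) \<in> borel_measurable borel"
    using borel_measurable_integrable by fastforce
  note meas [measurable] = this
  show "integrable M (\<lambda>\<omega>. N1 (x * Z2 \<omega>))"
    using intQ by (subst (asm) integrable_distr_eq) auto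
  have "generated_norm M (\<lambda>\<omega>. Z1 \<omega> * Z2 \<omega>) x = (\<integral>\<omega>. h (Z1 \<omega>, Z2 \<omega>) \<partial>M)"
    unfolding generated_norm_def
    using eq by (intro integral_cong_AE) (auto intro!: borel_measurable_Max)
  also have "\<dots> = (\<integral>p. h p \<partial>(?P \<Otimes>\<^sub>M ?Q))"
    unfolding joint by (simp add: integral_distr)
  also have "\<dots> = (\<integral>z. N1 (x * z) \<partial>?Q)"
    using PQ.integral_snd[of "\<lambda>y z. h (y, z)"] int by (simp add: inner)
  also have "\<dots> = (\<integral>\<omega>. N1 (x * Z2 \<omega>) \<partial>M)"
    by (simp add: integral_distr)
  finally show "generated_norm M (\<lambda>\<omega>. Z1 \<omega> * Z2 \<omega>) x = (\<integral>\<omega>. N1 (x * Z2 \<omega>) \<partial>M)" .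
qed

lemma generated_norm_prod_unique:
  assumes Z: "indep_generators M Z1 Z2 N1 N2" and W: "indep_generators M' W1 W2 N1 N2"
  shows "generated_norm M (\<lambda>\<omega>. Z1 \<omega> * Z2 \<omega>) = generated_norm M' (\<lambda>\<omega>. W1 \<omega> * W2 \<omega>)"
proof
  fix x
  note gZ = indep_generatorsD[OF Z] and gW = indep_generatorsD[OF W]
  interpret M: prob_space M by (rule generatesD(1)[OF gZ(1)])
  interpret M': prob_space M' by (rule generatesD(1)[OF gW(1)])
  interpret pair_prob_space M M' ..
  let ?p = "generated_norm (M \<Otimes>\<^sub>M M') (\<lambda>\<omega>. Z1 (fst \<omega>) * W2 (snd \<omega>)) x"
  have mix: "indep_generators (M \<Otimes>\<^sub>M M') (\<lambda>\<omega>. Z1 (fst \<omega>)) (\<lambda>\<omega>. W2 (snd \<omega>)) N1 N2"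
    by (rule indep_generators_pair[OF gZ(1) gW(2)])
  \<comment> \<open>Averaging over \<open>Z2\<close> first leaves \<open>N2\<close> and the law of
    \<open>Z1\<close>, both shared with the coupling, so \<open>Z2\<close> can be exchanged for
    \<open>W2\<close>.\<close>
  have "generated_norm M (\<lambda>\<omega>. Z1 \<omega> * Z2 \<omega>) x = (\<integral>\<omega>. N2 (x * Z1 \<omega>) \<partial>M)"
    using generated_norm_prod(2)[OF indep_generators_sym[OF Z]] by (simp add: mult.commute)
  also have "\<dots> = (\<integral>\<omega>. N2 (x * Z1 (fst \<omega>)) \<partial>(M \<Otimes>\<^sub>M M'))"
    using integral_fst'[OF generated_norm_prod(1)[OF indep_generators_sym[OF mix]], of x]
    by (simp add: M'.prob_space)
  also have "\<dots> = ?p"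
    using generated_norm_prod(2)[OF indep_generators_sym[OF mix]] by (simp add: mult.commute)
  \<comment> \<open>Averaging over \<open>Z1\<close> first leaves only \<open>N1\<close> and
    \<open>W2\<close>, so \<open>W1\<close> can take the place of \<open>Z1\<close>.\<close>
  also have "\<dots> = (\<integral>\<omega>. N1 (x * W2 (snd \<omega>)) \<partial>(M \<Otimes>\<^sub>M M'))"
    by (rule generated_norm_prod(2)[OF mix])
  also have "\<dots> = (\<integral>\<omega>. N1 (x * W2 \<omega>) \<partial>M')"
    using integral_fst'[OF generated_norm_prod(1)[OF mix], of x] by (simp add: M.prob_space)
  also have "\<dots> = generated_norm M' (\<lambda>\<omega>. W1 \<omega> * W2 \<omega>) x"
    by (rule generated_norm_prod(2)[OF W, symmetric])
  finally show "generated_norm M (\<lambda>\<omega>. Z1 \<omega> * Z2 \<omega>) x = generated_norm M' (\<lambda>\<omega>. W1 \<omega> * W2 \<omega>) x" .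
qed

section \<open>The multiplication of D-norms\<close>

text \<open>A product of two measures on \<open>real ^ 'n\<close> has the sample space type fixed in
  \<open>D_norm_mult\<close>, so the description there has a witness.\<close>

lemma ex_indep_generators:
  fixes N1 N2 :: "real ^ 'n \<Rightarrow> real"
  assumes "N1 \<in> D_norms" and "N2 \<in> D_norms"
  shows "\<exists>(M :: ((real ^ 'n) \<times> (real ^ 'n)) measure) Z1 Z2. indep_generators M Z1 Z2 N1 N2"
  using assms indep_generators_pair unfolding D_norms_def by blast

text \<open>Uniqueness compares sample spaces of different types, so the type fixed in the
  definition does not restrict \<open>M\<close>.\<close>

lemma D_norm_mult_eq:
  fixes N1 N2 :: "real ^ 'n \<Rightarrow> real"
  assumes Z: "indep_generators M Z1 Z2 N1 N2"
  shows "D_norm_mult N1 N2 = generated_norm M (\<lambda>\<omega>. Z1 \<omega> * Z2 \<omega>)"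
proof -
  have "N1 \<in> D_norms" "N2 \<in> D_norms"
    using indep_generatorsD(1,2)[OF Z] generates_imp_D_norm by blast+
  then obtain M' :: "((real ^ 'n) \<times> (real ^ 'n)) measure" and W1 W2
    where W: "indep_generators M' W1 W2 N1 N2"
    using ex_indep_generators by blast
  show ?thesis
    unfolding D_norm_mult_def
  proof (rule the_equality)
    show "\<exists>(M' :: ((real ^ 'n) \<times> (real ^ 'n)) measure) W1 W2. indep_generators M' W1 W2 N1 N2 \<and>
        generates M' (\<lambda>\<omega>. W1 \<omega> * W2 \<omega>) (generated_norm M (\<lambda>\<omega>. Z1 \<omega> * Z2 \<omega>))"
      using W indep_generators_prod[OF W] generated_norm_prod_unique[OF Z W] by metis
  next
    fix N
    assume "\<exists>(M' :: ((real ^ 'n) \<times> (real ^ 'n)) measure) W1 W2.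
      indep_generators M' W1 W2 N1 N2 \<and> generates M' (\<lambda>\<omega>. W1 \<omega> * W2 \<omega>) N"
    then show "N = generated_norm M (\<lambda>\<omega>. Z1 \<omega> * Z2 \<omega>)"
      using generated_norm_prod_unique[OF Z] generatesD(6) by metis
  qed
qed

lemma generates_D_norm_mult:
  assumes "indep_generators M Z1 Z2 N1 N2"
  shows "generates M (\<lambda>\<omega>. Z1 \<omega> * Z2 \<omega>) (D_norm_mult N1 N2)"
  using indep_generators_prod[OF assms] by (simp add: D_norm_mult_eq[OF assms])

lemma D_norm_mult_closed:
  assumes "N1 \<in> D_norms" and "N2 \<in> D_norms"
  shows "D_norm_mult N1 N2 \<in> D_norms"
  using ex_indep_generators[OF assms] generates_D_norm_mult generates_imp_D_norm by blast

lemma D_norm_mult_commute: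
  fixes N1 N2 :: "real ^ 'n \<Rightarrow> real"
  assumes "N1 \<in> D_norms" and "N2 \<in> D_norms"
  shows "D_norm_mult N1 N2 = D_norm_mult N2 N1"
proof -
  obtain M :: "((real ^ 'n) \<times> (real ^ 'n)) measure" and Z1 Z2
    where Z: "indep_generators M Z1 Z2 N1 N2"
    using ex_indep_generators[OF assms] by blast
  show ?thesis
    using D_norm_mult_eq[OF Z] D_norm_mult_eq[OF indep_generators_sym[OF Z]]
    by (simp add: mult.commute)
qed

text \<open>Associativity and the unit law rest on this form, where \<open>N1\<close> enters only as
  a function. In the product coupling with a generator of \<open>N1\<close>, the first coordinate
  integrates out to total mass 1.\<close>

lemma D_norm_mult_integral:
  fixes N1 N2 :: "real ^ 'n \<Rightarrow> real"
  assumes "N1 \<in> D_norms" and Z: "generates M Z N2"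
  shows "D_norm_mult N1 N2 x = (\<integral>\<omega>. N1 (x * Z \<omega>) \<partial>M)"
proof -
  obtain M1 :: "(real ^ 'n) measure" and Z1 where Z1: "generates M1 Z1 N1"
    using assms(1) unfolding D_norms_def by blast
  interpret M1: prob_space M1 by (rule generatesD(1)[OF Z1])
  interpret M: prob_space M by (rule generatesD(1)[OF Z])
  interpret pair_prob_space M1 M ..
  note p = indep_generators_pair[OF Z1 Z]
  have "D_norm_mult N1 N2 x = (\<integral>\<omega>. N1 (x * Z (snd \<omega>)) \<partial>(M1 \<Otimes>\<^sub>M M))"
    by (simp add: D_norm_mult_eq[OF p] generated_norm_prod(2)[OF p])
  also have "\<dots> = (\<integral>\<omega>. N1 (x * Z \<omega>) \<partial>M)"
    using integral_fst'[OF generated_norm_prod(1)[OF p], of x] by (simp add: M1.prob_space)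
  finally show ?thesis .
qed

lemma D_norm_mult_integrable:
  fixes N1 N2 :: "real ^ 'n \<Rightarrow> real"
  assumes "N1 \<in> D_norms" and Z: "generates M Z N2"
  shows "integrable M (\<lambda>\<omega>. N1 (x * Z \<omega>))"
proof -
  obtain M1 :: "(real ^ 'n) measure" and Z1 where Z1: "generates M1 Z1 N1"
    using assms(1) unfolding D_norms_def by blast
  interpret M1: prob_space M1 by (rule generatesD(1)[OF Z1])
  interpret M: prob_space M by (rule generatesD(1)[OF Z])
  interpret pair_prob_space M1 M ..
  show ?thesis
    \<comment> \<open>The integrand is constant in the first coordinate, so integrating over
      \<open>M1\<close>, of mass 1, returns it unchanged.\<close>
    using integrable_snd[of "\<lambda>_ \<omega>. N1 (x * Z \<omega>)"]
      generated_norm_prod(1)[OF indep_generators_pair[OF Z1 Z], of x]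
    by (simp add: case_prod_beta' M1.prob_space)
qed

text \<open>Both sides are the expectation of \<open>N1 (x * Z2 * Z3)\<close> under an independent
  coupling of \<open>Z2\<close> and \<open>Z3\<close>.\<close>

lemma D_norm_mult_assoc:
  fixes N1 N2 N3 :: "real ^ 'n \<Rightarrow> real"
  assumes "N1 \<in> D_norms" and "N2 \<in> D_norms" and "N3 \<in> D_norms"
  shows "D_norm_mult (D_norm_mult N1 N2) N3 = D_norm_mult N1 (D_norm_mult N2 N3)"
proof
  fix x
  obtain M2 :: "(real ^ 'n) measure" and Z2 where Z2: "generates M2 Z2 N2"
    using assms(2) unfolding D_norms_def by blast
  obtain M3 :: "(real ^ 'n) measure" and Z3 where Z3: "generates M3 Z3 N3"
    using assms(3) unfolding D_norms_def by blast
  interpret M2: prob_space M2 by (rule generatesD(1)[OF Z2])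
  interpret M3: prob_space M3 by (rule generatesD(1)[OF Z3])
  interpret pair_prob_space M3 M2 ..
  note g = generates_D_norm_mult[OF indep_generators_sym[OF indep_generators_pair[OF Z3 Z2]]]
  have "D_norm_mult N1 (D_norm_mult N2 N3) x =
      (\<integral>\<omega>. N1 (x * (Z2 (snd \<omega>) * Z3 (fst \<omega>))) \<partial>(M3 \<Otimes>\<^sub>M M2))"
    by (rule D_norm_mult_integral[OF assms(1) g])
  also have "\<dots> = (\<integral>\<omega>3. \<integral>\<omega>2. N1 (x * Z3 \<omega>3 * Z2 \<omega>2) \<partial>M2 \<partial>M3)"
    using integral_fst'[OF D_norm_mult_integrable[OF assms(1) g, of x]] by (simp add: mult_ac)
  also have "\<dots> = D_norm_mult (D_norm_mult N1 N2) N3 x"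
    by (simp add: D_norm_mult_integral[OF D_norm_mult_closed[OF assms(1,2)] Z3]
        D_norm_mult_integral[OF assms(1) Z2])
  finally show "D_norm_mult (D_norm_mult N1 N2) N3 x = D_norm_mult N1 (D_norm_mult N2 N3) x" ..
qed

section \<open>The identity element and the monoid\<close>

lemma generates_infnorm:
  assumes "prob_space M"
  shows "generates M (\<lambda>_. 1) (infnorm :: real ^ 'n \<Rightarrow> real)"
proof -
  interpret prob_space M by fact
  show ?thesis
    by (auto simp: generates_def generator_def generated_norm_def infnorm_eq_MAX prob_space
        assms fun_eq_iff)
qed

text \<open>The all-ones vector \<open>1\<close> generates \<open>infnorm\<close> and is neutral for
  the componentwise product, so the integrand is the constant \<open>N x\<close>.\<close>

lemma D_norm_mult_infnorm:
  fixes N :: "real ^ 'n \<Rightarrow> real"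
  assumes "N \<in> D_norms"
  shows "D_norm_mult N infnorm = N"
proof
  fix x
  \<comment> \<open>Any probability space carries the constant generator; a point mass
    serves.\<close>
  interpret R: prob_space "return borel (0 :: real)" by (rule prob_space_return) simp
  show "D_norm_mult N infnorm x = N x"
    using D_norm_mult_integral[OF assms generates_infnorm[OF R.prob_space_axioms]]
    by (simp add: R.prob_space[simplified])
qed

lemma infnorm_D_norm: "(infnorm :: real ^ 'n \<Rightarrow> real) \<in> D_norms"
  by (rule generates_imp_D_norm[OF generates_infnorm[OF prob_space_return[of "0::real" borel]]]) simp

lemma comm_monoid_D_norm_monoid: "comm_monoid (D_norm_monoid :: (real ^ 'n \<Rightarrow> real) monoid)"
proof (rule comm_monoidI)
  fix N :: "real ^ 'n \<Rightarrow> real"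
  assume "N \<in> carrier D_norm_monoid"
  \<comment> \<open>The left unit law follows from the right one by commutativity.\<close>
  then show "\<one>\<^bsub>D_norm_monoid\<^esub> \<otimes>\<^bsub>D_norm_monoid\<^esub> N = N"
    using D_norm_mult_commute[OF infnorm_D_norm, of N] D_norm_mult_infnorm[of N]
    by (simp add: D_norm_monoid_def)
qed (auto simp: D_norm_monoid_def infnorm_D_norm
    intro: D_norm_mult_closed D_norm_mult_assoc D_norm_mult_commute)

theorem mainTheorem1:
  shows
    "(\<forall>N1 \<in> (D_norms :: (real ^ 'n \<Rightarrow> real) set). \<forall>N2 \<in> D_norms.
        \<exists>(M :: ((real ^ 'n) \<times> (real ^ 'n)) measure) Z1 Z2. indep_generators M Z1 Z2 N1 N2) \<and>
     (\<forall>(N1 :: real ^ 'n \<Rightarrow> real) N2 (M :: 'a measure) Z1 Z2. indep_generators M Z1 Z2 N1 N2 \<longrightarrow>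
        generates M (\<lambda>\<omega>. Z1 \<omega> * Z2 \<omega>) (D_norm_mult N1 N2)) \<and>
     (\<forall>(N1 :: real ^ 'n \<Rightarrow> real) N2 (M :: 'a measure) Z1 Z2 (M' :: 'b measure) W1 W2.
        indep_generators M Z1 Z2 N1 N2 \<longrightarrow> indep_generators M' W1 W2 N1 N2 \<longrightarrow>
        generated_norm M (\<lambda>\<omega>. Z1 \<omega> * Z2 \<omega>) = generated_norm M' (\<lambda>\<omega>. W1 \<omega> * W2 \<omega>)) \<and>
     comm_monoid (D_norm_monoid :: (real ^ 'n \<Rightarrow> real) monoid)"
  using ex_indep_generators generates_D_norm_mult generated_norm_prod_unique
    comm_monoid_D_norm_monoid
  by (intro conjI allI ballI impI) blast+

end
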